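(* Suppose $(X_i,Y_i)_{i=1,\dots,n}$ (the calibration set) and $(X_{\text{test}},Y_{\text{test}})$ are independent and identically distributed. Let $\hat q$ be the $\frac{\lceil (n+1)(1-\alpha)\rceil}{n}$ quantile of the LofreeCP nonconformity scores of the calibration set, and let $$C_{1-\alpha}(X_{\text{test}})=\{\,y : N(X_{\text{test}},y)\le \hat q\,\}$$ be the LofreeCP prediction set, where $N$ is the LofreeCP nonconformity score and $y$ runs over the responses sampled for $X_{\text{test}}$. Then $$P\{Y_{\text{test}}\in C_{1-\alpha}(X_{\text{test}})\}\ \ge\ 1-\alpha,$$ where $\alpha\in(0,1)$ denotes the desired error rate.
   Context: LofreeCP is a split conformal prediction method for a large language model (LLM) whose logits are not accessible. $X$ is a prompt and $Y$ its true response (label). For each prompt $x$ (calibration or test), $m$ responses $\hat y_1,\dots,\hat y_m$ are sampled from the LLM, and the distinct ones form the response pool of that prompt. For a response $y$ in the pool of $x$: - Frequency: $F(y)=\frac1m\#\{j:\hat y_j=y\}$. - Normalized entropy of the prompt: $H(x)=\left|\frac{\sum_a F(a)\log F(a)}{\log m}\right|$, the sum being over the distinct responses $a$ in the pool. - Semantic similarity: $SS(y)=\frac{\mathbf v(y)\cdot \mathbf v(P_{\text{highest}})}{\|\mathbf v(y)\|\,\|\mathbf v(P_{\text{highest}})\|}$, where $\mathbf v(\cdot)$ is a vector representation of a response and $P_{\text{highest}}$ is the response in the pool with the highest frequency. If $y$ is itself $P_{\text{highest}}$, the similarity term is not considered. The nonconformity score of a response $y$ in the pool is $$N(x,y)=-F(y)+\lambda_1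 H(x)-\lambda_2\,SS(y),$$ where $\lambda=(\lambda_1,\lambda_2)$ is a hyperparameter configuration. In the method, $\lambda$ is chosen using a separate validation set, calibration and validation being run for different candidate configurations and the best one being used for testing. Calibration: the nonconformity score of calibration sample $i$ is $N(X_i,Y_i)$ if the true label $Y_i$ is in the pool of $X_i$, and $\infty$ otherwise. The quantile $\hat q$ is taken over these $n$ scores. Test: all responses in the pool of $X_{\text{test}}$ are traversed, their scores computed, and those with score at most $\hat q$ are kept in the prediction set.
   Formalization: When q̂ is infinite, C also includes responses outside the pool (score ∞); for C restricted to sampled responses the bound is claimed only if almost surely Y_test is sampled whenever q̂=∞. Otherwise it fails: an LLM never sampling the true label has coverage 0. *)

theory Defs
  imports "HOL-Probability.Probability"
begin

text \<open>
  Responses are texts, so they live in a countable type 'r carrying the discrete sigma-algebra;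
  prompts live in an arbitrary measurable space.  The responses sampled for one prompt are the list
  rs of its m draws, repetitions included; the response pool is set rs.
\<close>

definition freq :: "'r list \<Rightarrow> 'r \<Rightarrow> real" where
  "freq rs y = real (count_list rs y) / real (length rs)"

text \<open>For a single draw the quotient is 0 / 0, which HOL evaluates to 0.\<close>

definition norm_entropy :: "'r list \<Rightarrow> real" where
  "norm_entropy rs = \<bar>(\<Sum>a\<in>set rs. freq rs a * ln (freq rs a)) / ln (real (length rs))\<bar>"

text \<open>
  Several responses may share the highest frequency.  A rule that designates one of them is a
  parameter of the method.
\<close>

definition highest_freq_rule :: "('r list \<Rightarrow> 'r) \<Rightarrow> bool" where
  "highest_freq_rule top_resp \<longleftrightarrow>
     (\<forall>rs. rs \<noteq> [] \<longrightarrow>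
        top_resp rs \<in> set rs \<and> (\<forall>a\<in>set rs. freq rs a \<le> freq rs (top_resp rs)))"

definition cosine_sim :: "'v::real_inner \<Rightarrow> 'v \<Rightarrow> real" where
  "cosine_sim u w = (u \<bullet> w) / (norm u * norm w)"

text \<open>The score depends on the prompt only through the responses sampled for it.\<close>

definition pool_score ::
    "('r \<Rightarrow> 'v::real_inner) \<Rightarrow> ('r list \<Rightarrow> 'r) \<Rightarrow> real \<times> real \<Rightarrow> 'r list \<Rightarrow> 'r \<Rightarrow> real" where
  "pool_score emb top_resp lam rs y =
     - freq rs y + fst lam * norm_entropy rs
     - (if y = top_resp rs then 0 else snd lam * cosine_sim (emb y) (emb (top_resp rs)))"

definition lofree_score ::
    "('r \<Rightarrow> 'v::real_inner) \<Rightarrow> ('r list \<Rightarrow> 'r) \<Rightarrow> real \<times> real \<Rightarrow> 'r list \<Rightarrow> 'r \<Rightarrow> ereal" where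
  "lofree_score emb top_resp lam rs y =
     (if y \<in> set rs then ereal (pool_score emb top_resp lam rs y) else \<infinity>)"

text \<open>
  The empirical quantile at level b of the scores s 1, ..., s n is the least q such that at least
  the fraction b of the scores is at most q.  For b > 1 no such q exists, and the infimum of the
  empty set is \<open>\<infinity>\<close>, the usual convention of split conformal prediction.
\<close>

definition emp_quantile :: "nat \<Rightarrow> (nat \<Rightarrow> ereal) \<Rightarrow> real \<Rightarrow> ereal" where
  "emp_quantile n s b = Inf {q. b \<le> real (card {i\<in>{1..n}. s i \<le> q}) / real n}"

definition conformal_quantile :: "real \<Rightarrow> nat \<Rightarrow> (nat \<Rightarrow> ereal) \<Rightarrow> ereal" where
  "conformal_quantile \<alpha> n s =
     emp_quantile n s (real_of_int \<lceil>(real n + 1) * (1 - \<alpha>)\<rceil> / real n)"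

text \<open>The prediction set obtained by traversing the pool.\<close>

definition lofree_set ::
    "('r \<Rightarrow> 'v::real_inner) \<Rightarrow> ('r list \<Rightarrow> 'r) \<Rightarrow> real \<times> real \<Rightarrow> 'r list \<Rightarrow> ereal \<Rightarrow> 'r set" where
  "lofree_set emb top_resp lam rs q = {y\<in>set rs. ereal (pool_score emb top_resp lam rs y) \<le> q}"

text \<open>
  The same threshold rule applied to all responses, those outside the pool having the score
  \<open>\<infinity>\<close> that calibration gives them.  It differs from the preceding set only for an infinite
  threshold, where it excludes no response.
\<close>

definition lofree_set_ext ::
    "('r \<Rightarrow> 'v::real_inner) \<Rightarrow> ('r list \<Rightarrow> 'r) \<Rightarrow> real \<times> real \<Rightarrow> 'r list \<Rightarrow> ereal \<Rightarrow> 'r set" where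
  "lofree_set_ext emb top_resp lam rs q = {y. lofree_score emb top_resp lam rs y \<le> q}"

lemma lofree_set_ext_eq:
  "lofree_set_ext emb top_resp lam rs q =
     (if q = \<infinity> then UNIV else lofree_set emb top_resp lam rs q)"
  by (auto simp: lofree_set_ext_def lofree_set_def lofree_score_def)

text \<open>
  The sampling mechanism: conditionally on all prompts and true responses with index in I, the
  lists R i are independent and R i consists of m independent draws from the distribution
  llm (X i) of the language model.  This is expressed by the conditional probability of each
  outcome given the sigma-algebra generated by the pairs (X i, Y i).
\<close>

definition sampled_from_llm ::
    "'w measure \<Rightarrow> 'x measure \<Rightarrow> ('x \<Rightarrow> 'r pmf) \<Rightarrow> nat \<Rightarrow> nat set \<Rightarrow>
     (nat \<Rightarrow> 'w \<Rightarrow> 'x) \<Rightarrow> (nat \<Rightarrow> 'w \<Rightarrow> 'r) \<Rightarrow> (nat \<Rightarrow> 'w \<Rightarrow> 'r list) \<Rightarrow> bool" where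
  "sampled_from_llm M MX llm m I X Y R \<longleftrightarrow>
     (\<forall>i\<in>I. R i \<in> M \<rightarrow>\<^sub>M count_space UNIV) \<and>
     (\<forall>rs. AE \<omega> in M.
        real_cond_exp M
          (vimage_algebra (space M) (\<lambda>\<omega>. \<lambda>i\<in>I. (X i \<omega>, Y i \<omega>))
             (\<Pi>\<^sub>M i\<in>I. MX \<Otimes>\<^sub>M count_space UNIV))
          (indicator {\<omega>\<in>space M. \<forall>i\<in>I. R i \<omega> = rs i}) \<omega> =
        (\<Prod>i\<in>I. pmf (replicate_pmf m (llm (X i \<omega>))) (rs i)))"

text \<open>
  Independence of two random variables of different types, which the library's indep_var does not
  cover, as independence of the sigma-algebras they generate.
\<close>

definition indep_rvs ::
    "'w measure \<Rightarrow> 'a measure \<Rightarrow> ('w \<Rightarrow> 'a) \<Rightarrow> 'b measure \<Rightarrow> ('w \<Rightarrow> 'b) \<Rightarrow> bool" where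
  "indep_rvs M A U B V \<longleftrightarrow>
     U \<in> M \<rightarrow>\<^sub>M A \<and> V \<in> M \<rightarrow>\<^sub>M B \<and>
     prob_space.indep_set M (sets (vimage_algebra (space M) U A)) (sets (vimage_algebra (space M) V B))"

end

theory Submission
  imports Defs
begin

text \<open>
  Conditioning on the prompts and true responses factorizes the joint law of the pairs
  (true response, sampled list) into identical factors, so these pairs are exchangeable.  The true
  test response is covered by the threshold rule exactly when fewer than
  \<open>k = \<lceil>(n + 1) (1 - \<alpha>)\<rceil>\<close> of the \<open>n + 1\<close> scores are strictly below its own.  For every
  realization at least \<open>k\<close> of the indices have this property, and by exchangeability each index has
  it with the same probability, which is therefore at least \<open>k / (n + 1) \<ge> 1 - \<alpha>\<close>.  As the hyperparameters
  are independent of these pairs and the pairs take countably many values, the random choice of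
  hyperparameters is handled by summing over the values of the pairs.
\<close>

lemma card_rank_less_ge:
  fixes s :: "'i \<Rightarrow> 'a::linorder"
  assumes "finite I" and "k \<le> card I"
  shows "k \<le> card {j\<in>I. card {i\<in>I. s i < s j} < k}"
proof (cases "\<forall>j\<in>I. card {i\<in>I. s i < s j} < k")
  case True
  then have "{j\<in>I. card {i\<in>I. s i < s j} < k} = I" by auto
  then show ?thesis using assms by simp
next
  case False
  define B where "B = {j\<in>I. k \<le> card {i\<in>I. s i < s j}}"
  have "finite (s ` B)" "s ` B \<noteq> {}"
    using False assms(1) by (auto simp: B_def not_less)
  then have "Min (s ` B) \<in> s ` B" by (rule Min_in)
  then obtain j where j: "j \<in> B" "s j = Min (s ` B)" by auto
  have least: "s j \<le> s i" if "i \<in> B" for i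
    using that j(2) \<open>finite (s ` B)\<close> by simp
  have "{i\<in>I. s i < s j} \<subseteq> {j\<in>I. card {i\<in>I. s i < s j} < k}"
    using least unfolding B_def by (force simp: not_less)
  then have "card {i\<in>I. s i < s j} \<le> card {j\<in>I. card {i\<in>I. s i < s j} < k}"
    using assms(1) by (intro card_mono) auto
  then show ?thesis using j(1) by (simp add: B_def)
qed

lemma le_conformal_quantile_iff:
  assumes "0 < n" and "\<alpha> < 1"
  shows "s (n + 1) \<le> conformal_quantile \<alpha> n s \<longleftrightarrow>
    card {i\<in>{1..n+1}. s i < s (n + 1)} < nat \<lceil>(real n + 1) * (1 - \<alpha>)\<rceil>"
    (is "_ \<longleftrightarrow> card ?L < nat ?k")
proof -
  have kpos: "0 < ?k"
    using assms by (simp add: zero_less_ceiling)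
  have level: "real_of_int ?k / real n \<le> real c / real n \<longleftrightarrow> nat ?k \<le> c" for c
  proof -
    have "real_of_int ?k / real n \<le> real c / real n \<longleftrightarrow> real_of_int ?k \<le> real c"
      using assms(1) by (simp add: divide_le_cancel)
    also have "\<dots> \<longleftrightarrow> nat ?k \<le> c" by linarith
    finally show ?thesis .
  qed
  have L: "?L = {i\<in>{1..n}. s i < s (n + 1)}"
    by (auto simp: le_Suc_eq)
  have "s (n + 1) \<le> conformal_quantile \<alpha> n s \<longleftrightarrow>
      (\<forall>q. nat ?k \<le> card {i\<in>{1..n}. s i \<le> q} \<longrightarrow> s (n + 1) \<le> q)"
    unfolding conformal_quantile_def emp_quantile_def level by (simp add: le_Inf_iff)
  also have "\<dots> \<longleftrightarrow> card ?L < nat ?k"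
  proof
    assume q: "\<forall>q. nat ?k \<le> card {i\<in>{1..n}. s i \<le> q} \<longrightarrow> s (n + 1) \<le> q"
    show "card ?L < nat ?k"
    proof (rule ccontr)
      assume "\<not> card ?L < nat ?k"
      then have ge: "nat ?k \<le> card ?L" by (rule leI)
      then have "card ?L \<noteq> 0" using kpos by linarith
      then have "?L \<noteq> {}" by (metis card.empty)
      then have *: "finite (s ` ?L)" "s ` ?L \<noteq> {}" by (simp, blast)
      define q where "q = Max (s ` ?L)"
      have "q \<in> s ` ?L" unfolding q_def using * by (rule Max_in)
      then have "q < s (n + 1)" by auto
      have "?L \<subseteq> {i\<in>{1..n}. s i \<le> q}"
        using *(1) unfolding q_def L by auto
      then have "card ?L \<le> card {i\<in>{1..n}. s i \<le> q}"
        by (intro card_mono) auto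
      with ge q have "s (n + 1) \<le> q" by auto
      with \<open>q < s (n + 1)\<close> show False by simp
    qed
  next
    assume less: "card ?L < nat ?k"
    show "\<forall>q. nat ?k \<le> card {i\<in>{1..n}. s i \<le> q} \<longrightarrow> s (n + 1) \<le> q"
    proof (intro allI impI)
      fix q assume q: "nat ?k \<le> card {i\<in>{1..n}. s i \<le> q}"
      show "s (n + 1) \<le> q"
      proof (rule ccontr)
        assume "\<not> s (n + 1) \<le> q"
        then have "card {i\<in>{1..n}. s i \<le> q} \<le> card ?L"
          unfolding L by (intro card_mono) auto
        with q less show False by linarith
      qed
    qed
  qed
  finally show ?thesis .
qed

lemma (in prob_space) emeasure_countable_disintegration:
  fixes Z :: "'i \<Rightarrow> 'a \<Rightarrow> 'c::countable"
  assumes I: "finite I"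
    and L[measurable]: "L \<in> M \<rightarrow>\<^sub>M N"
    and Z[measurable]: "\<And>i. i \<in> I \<Longrightarrow> Z i \<in> M \<rightarrow>\<^sub>M count_space UNIV"
    and indep: "\<And>A z. A \<in> sets N \<Longrightarrow>
      prob {\<omega>\<in>space M. L \<omega> \<in> A \<and> (\<forall>i\<in>I. Z i \<omega> = z i)} =
      prob {\<omega>\<in>space M. L \<omega> \<in> A} * prob {\<omega>\<in>space M. \<forall>i\<in>I. Z i \<omega> = z i}"
    and Q: "\<And>z. {l\<in>space N. Q l z} \<in> sets N"
  shows "emeasure M {\<omega>\<in>space M. Q (L \<omega>) (\<lambda>i\<in>I. Z i \<omega>)} =
    (\<integral>\<^sup>+z. ennreal (prob {\<omega>\<in>space M. Q (L \<omega>) z} * prob {\<omega>\<in>space M. \<forall>i\<in>I. Z i \<omega> = z i})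
       \<partial>count_space (I \<rightarrow>\<^sub>E UNIV))"
proof -
  define E where "E z = {\<omega>\<in>space M. L \<omega> \<in> {l\<in>space N. Q l z} \<and> (\<forall>i\<in>I. Z i \<omega> = z i)}" for z
  have space_L: "L \<omega> \<in> space N" if "\<omega> \<in> space M" for \<omega>
    using measurable_space[OF L that] .
  have E_sets: "E z \<in> sets M" for z
  proof -
    have "{\<omega>\<in>space M. \<forall>i\<in>I. Z i \<omega> = z i} \<in> sets M"
      using I by measurable
    moreover have "L -` {l\<in>space N. Q l z} \<inter> space M \<in> sets M"
      using L Q by (rule measurable_sets)
    ultimately have "(L -` {l\<in>space N. Q l z} \<inter> space M) \<inter> {\<omega>\<in>space M. \<forall>i\<in>I. Z i \<omega> = z i} \<in> sets M"
      by (rule sets.Int[rotated])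
    also have "(L -` {l\<in>space N. Q l z} \<inter> space M) \<inter> {\<omega>\<in>space M. \<forall>i\<in>I. Z i \<omega> = z i} = E z"
      by (auto simp: E_def)
    finally show ?thesis .
  qed
  have disj: "disjoint_family_on E (I \<rightarrow>\<^sub>E UNIV)"
  proof (unfold disjoint_family_on_def, intro ballI impI)
    fix z z' :: "'i \<Rightarrow> 'c"
    assume z: "z \<in> I \<rightarrow>\<^sub>E UNIV" "z' \<in> I \<rightarrow>\<^sub>E UNIV" "z \<noteq> z'"
    then obtain i where "i \<in> I" "z i \<noteq> z' i" by (metis PiE_ext)
    then show "E z \<inter> E z' = {}" by (auto simp: E_def)
  qed
  have "{\<omega>\<in>space M. Q (L \<omega>) (\<lambda>i\<in>I. Z i \<omega>)} = (\<Union>z\<in>I \<rightarrow>\<^sub>E UNIV. E z)"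
  proof (intro equalityI subsetI)
    fix \<omega> assume "\<omega> \<in> {\<omega>\<in>space M. Q (L \<omega>) (\<lambda>i\<in>I. Z i \<omega>)}"
    then show "\<omega> \<in> (\<Union>z\<in>I \<rightarrow>\<^sub>E UNIV. E z)"
      by (intro UN_I[of "\<lambda>i\<in>I. Z i \<omega>"]) (auto simp: E_def space_L)
  next
    fix \<omega> assume "\<omega> \<in> (\<Union>z\<in>I \<rightarrow>\<^sub>E UNIV. E z)"
    then obtain z where z: "z \<in> I \<rightarrow>\<^sub>E UNIV" "\<omega> \<in> E z" by auto
    then have "(\<lambda>i\<in>I. Z i \<omega>) = z"
      by (auto simp: E_def fun_eq_iff PiE_def extensional_def)
    with z show "\<omega> \<in> {\<omega>\<in>space M. Q (L \<omega>) (\<lambda>i\<in>I. Z i \<omega>)}"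
      by (auto simp: E_def)
  qed
  moreover have "emeasure M (\<Union>z\<in>I \<rightarrow>\<^sub>E UNIV. E z) =
      (\<integral>\<^sup>+z. emeasure M (E z) \<partial>count_space (I \<rightarrow>\<^sub>E UNIV))"
    using E_sets disj I by (intro emeasure_UN_countable countable_PiE) auto
  moreover have "emeasure M (E z) =
      ennreal (prob {\<omega>\<in>space M. Q (L \<omega>) z} * prob {\<omega>\<in>space M. \<forall>i\<in>I. Z i \<omega> = z i})" for z
  proof -
    have "{\<omega>\<in>space M. L \<omega> \<in> {l\<in>space N. Q l z}} = {\<omega>\<in>space M. Q (L \<omega>) z}"
      using space_L by auto
    then show ?thesis
      unfolding emeasure_eq_measure E_def using indep[OF Q, of z] by simp
  qed
  ultimately show ?thesis by simp
qed

lemma (in prob_space) exchangeable_prob_eq: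
  fixes Z :: "'i \<Rightarrow> 'a \<Rightarrow> 'c::countable"
  assumes I: "finite I"
    and L: "L \<in> M \<rightarrow>\<^sub>M N"
    and Z: "\<And>i. i \<in> I \<Longrightarrow> Z i \<in> M \<rightarrow>\<^sub>M count_space UNIV"
    and indep: "\<And>A z. A \<in> sets N \<Longrightarrow>
      prob {\<omega>\<in>space M. L \<omega> \<in> A \<and> (\<forall>i\<in>I. Z i \<omega> = z i)} =
      prob {\<omega>\<in>space M. L \<omega> \<in> A} * prob {\<omega>\<in>space M. \<forall>i\<in>I. Z i \<omega> = z i}"
    and \<sigma>: "\<sigma> permutes I"
    and exch: "\<And>z. prob {\<omega>\<in>space M. \<forall>i\<in>I. Z i \<omega> = z (\<sigma> i)} =
      prob {\<omega>\<in>space M. \<forall>i\<in>I. Z i \<omega> = z i}"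
    and Q: "\<And>z. {l\<in>space N. Q l z} \<in> sets N"
  shows "prob {\<omega>\<in>space M. Q (L \<omega>) (\<lambda>i\<in>I. Z (\<sigma> i) \<omega>)} =
    prob {\<omega>\<in>space M. Q (L \<omega>) (\<lambda>i\<in>I. Z i \<omega>)}"
proof -
  define g :: "('i \<Rightarrow> 'c) \<Rightarrow> 'i \<Rightarrow> 'c" where "g z = (\<lambda>i\<in>I. z (\<sigma> i))" for z
  have \<sigma>I: "\<sigma> i \<in> I \<longleftrightarrow> i \<in> I" for i
    using \<sigma> by (rule permutes_in_image)
  have inv: "inv \<sigma> i \<in> I \<longleftrightarrow> i \<in> I" for i
    using permutes_inv[OF \<sigma>] by (rule permutes_in_image)
  have g_bij: "bij_betw g (I \<rightarrow>\<^sub>E UNIV) (I \<rightarrow>\<^sub>E UNIV)"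
  proof (rule bij_betw_byWitness[where f' = "\<lambda>z. \<lambda>i\<in>I. z (inv \<sigma> i)"])
    show "\<forall>z\<in>I \<rightarrow>\<^sub>E UNIV. (\<lambda>i\<in>I. g z (inv \<sigma> i)) = z"
      by (auto simp: g_def inv fun_eq_iff PiE_def extensional_def permutes_inverses[OF \<sigma>])
    show "\<forall>z\<in>I \<rightarrow>\<^sub>E UNIV. g (\<lambda>i\<in>I. z (inv \<sigma> i)) = z"
      by (auto simp: g_def \<sigma>I fun_eq_iff PiE_def extensional_def permutes_inverses[OF \<sigma>])
  qed (auto simp: g_def)
  define f where "f z = ennreal (prob {\<omega>\<in>space M. Q (L \<omega>) z} *
    prob {\<omega>\<in>space M. \<forall>i\<in>I. Z i \<omega> = z i})" for z
  have "(\<lambda>i\<in>I. Z (\<sigma> i) \<omega>) = g (\<lambda>i\<in>I. Z i \<omega>)" for \<omega>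
    by (auto simp: g_def \<sigma>I fun_eq_iff)
  then have "emeasure M {\<omega>\<in>space M. Q (L \<omega>) (\<lambda>i\<in>I. Z (\<sigma> i) \<omega>)} =
      emeasure M {\<omega>\<in>space M. Q (L \<omega>) (g (\<lambda>i\<in>I. Z i \<omega>))}" by simp
  also have "\<dots> = (\<integral>\<^sup>+z. ennreal (prob {\<omega>\<in>space M. Q (L \<omega>) (g z)} *
      prob {\<omega>\<in>space M. \<forall>i\<in>I. Z i \<omega> = z i}) \<partial>count_space (I \<rightarrow>\<^sub>E UNIV))"
    by (rule emeasure_countable_disintegration[where Q = "\<lambda>l z. Q l (g z)", OF I L Z indep Q])
  also have "\<dots> = (\<integral>\<^sup>+z. f (g z) \<partial>count_space (I \<rightarrow>\<^sub>E UNIV))"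
  proof (rule nn_integral_cong)
    fix z
    have "{\<omega>\<in>space M. \<forall>i\<in>I. Z i \<omega> = g z i} = {\<omega>\<in>space M. \<forall>i\<in>I. Z i \<omega> = z (\<sigma> i)}"
      by (auto simp: g_def)
    then show "ennreal (prob {\<omega>\<in>space M. Q (L \<omega>) (g z)} *
      prob {\<omega>\<in>space M. \<forall>i\<in>I. Z i \<omega> = z i}) = f (g z)"
      using exch[of z] by (simp add: f_def)
  qed
  also have "\<dots> = (\<integral>\<^sup>+z. f z \<partial>count_space (I \<rightarrow>\<^sub>E UNIV))"
    using g_bij by (rule nn_integral_bij_count_space)
  also have "\<dots> = emeasure M {\<omega>\<in>space M. Q (L \<omega>) (\<lambda>i\<in>I. Z i \<omega>)}"
    unfolding f_def
    by (rule emeasure_countable_disintegration[OF I L Z indep Q, symmetric])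
  finally show ?thesis by (simp add: emeasure_eq_measure)
qed

lemma (in prob_space) prob_rank_less_ge:
  fixes Z :: "'i \<Rightarrow> 'a \<Rightarrow> 'c::countable" and S :: "'l \<Rightarrow> 'c \<Rightarrow> ereal"
  assumes I: "finite I"
    and L[measurable]: "L \<in> M \<rightarrow>\<^sub>M N"
    and Z[measurable]: "\<And>i. i \<in> I \<Longrightarrow> Z i \<in> M \<rightarrow>\<^sub>M count_space UNIV"
    and indep: "\<And>A z. A \<in> sets N \<Longrightarrow>
      prob {\<omega>\<in>space M. L \<omega> \<in> A \<and> (\<forall>i\<in>I. Z i \<omega> = z i)} =
      prob {\<omega>\<in>space M. L \<omega> \<in> A} * prob {\<omega>\<in>space M. \<forall>i\<in>I. Z i \<omega> = z i}"
    and exch: "\<And>\<sigma> z. \<sigma> permutes I \<Longrightarrow> prob {\<omega>\<in>space M. \<forall>i\<in>I. Z i \<omega> = z (\<sigma> i)} =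
      prob {\<omega>\<in>space M. \<forall>i\<in>I. Z i \<omega> = z i}"
    and S[measurable]: "\<And>c. (\<lambda>l. S l c) \<in> borel_measurable N"
    and j: "j \<in> I" and k: "k \<le> card I"
  shows "{\<omega>\<in>space M. card {i\<in>I. S (L \<omega>) (Z i \<omega>) < S (L \<omega>) (Z j \<omega>)} < k} \<in> events"
    and "real k \<le> real (card I) *
      prob {\<omega>\<in>space M. card {i\<in>I. S (L \<omega>) (Z i \<omega>) < S (L \<omega>) (Z j \<omega>)} < k}"
proof -
  define B where
    "B j = {\<omega>\<in>space M. card {i\<in>I. S (L \<omega>) (Z i \<omega>) < S (L \<omega>) (Z j \<omega>)} < k}" for j
  have card_sum: "card {i\<in>I. P i} = (\<Sum>i\<in>I. if P i then 1 else 0)" for P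
    using I by (simp add: sum.If_cases Int_def)
  have SZ[measurable]: "(\<lambda>\<omega>. S (L \<omega>) (Z i \<omega>)) \<in> borel_measurable M" if "i \<in> I" for i
    by (rule measurable_compose_countable[OF _ Z[OF that]]) measurable
  have B[measurable]: "B j \<in> events" if "j \<in> I" for j
    unfolding B_def card_sum using I that by measurable
  then show "{\<omega>\<in>space M. card {i\<in>I. S (L \<omega>) (Z i \<omega>) < S (L \<omega>) (Z j \<omega>)} < k} \<in> events"
    using j unfolding B_def by blast
  have eq: "prob (B i) = prob (B j)" if i: "i \<in> I" for i
  proof -
    define Q where "Q l z \<longleftrightarrow> card {h\<in>I. S l (z h) < S l (z j)} < k" for l z
    define \<tau> where "\<tau> = Transposition.transpose i j"
    have \<tau>: "\<tau> permutes I"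
      unfolding \<tau>_def using i j by (rule permutes_swap_id)
    have "Q (L \<omega>) (\<lambda>h\<in>I. Z (\<tau> h) \<omega>) \<longleftrightarrow>
        card {h\<in>I. S (L \<omega>) (Z h \<omega>) < S (L \<omega>) (Z i \<omega>)} < k" for \<omega>
    proof -
      have "bij_betw \<tau> {h\<in>I. S (L \<omega>) (Z (\<tau> h) \<omega>) < S (L \<omega>) (Z i \<omega>)}
          {h\<in>I. S (L \<omega>) (Z h \<omega>) < S (L \<omega>) (Z i \<omega>)}"
        by (rule bij_betw_byWitness[where f' = \<tau>])
          (auto simp: \<tau>_def permutes_in_image[OF \<tau>[unfolded \<tau>_def]])
      then have "card {h\<in>I. S (L \<omega>) (Z (\<tau> h) \<omega>) < S (L \<omega>) (Z i \<omega>)} =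
          card {h\<in>I. S (L \<omega>) (Z h \<omega>) < S (L \<omega>) (Z i \<omega>)}"
        by (rule bij_betw_same_card)
      moreover have "{h\<in>I. S (L \<omega>) ((\<lambda>h\<in>I. Z (\<tau> h) \<omega>) h) < S (L \<omega>) ((\<lambda>h\<in>I. Z (\<tau> h) \<omega>) j)} =
          {h\<in>I. S (L \<omega>) (Z (\<tau> h) \<omega>) < S (L \<omega>) (Z i \<omega>)}"
        using j by (auto simp: \<tau>_def)
      ultimately show ?thesis by (simp add: Q_def)
    qed
    then have Bi: "B i = {\<omega>\<in>space M. Q (L \<omega>) (\<lambda>h\<in>I. Z (\<tau> h) \<omega>)}"
      by (simp add: B_def)
    have "{h\<in>I. S l (restrict z I h) < S l (restrict z I j)} = {h\<in>I. S l (z h) < S l (z j)}" for l z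
      using j by auto
    then have Bj: "B j = {\<omega>\<in>space M. Q (L \<omega>) (\<lambda>h\<in>I. Z h \<omega>)}"
      by (simp only: B_def Q_def)
    have "{l\<in>space N. Q l z} \<in> sets N" for z
      unfolding Q_def card_sum by measurable
    then show ?thesis
      unfolding Bi Bj using I L Z indep \<tau> exch[OF \<tau>] by (intro exchangeable_prob_eq) auto
  qed
  have "real k = (\<integral>\<omega>. real k \<partial>M)" by (simp add: prob_space)
  also have "\<dots> \<le> (\<integral>\<omega>. (\<Sum>i\<in>I. indicator (B i) \<omega>) \<partial>M)"
  proof (rule integral_mono)
    fix \<omega> assume "\<omega> \<in> space M"
    then have "(\<Sum>i\<in>I. indicator (B i) \<omega>) =
        real (card {j\<in>I. card {i\<in>I. S (L \<omega>) (Z i \<omega>) < S (L \<omega>) (Z j \<omega>)} < k})"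
      unfolding card_sum[of "\<lambda>j. _ j < k"] by (auto simp: B_def indicator_def intro!: sum.cong)
    then show "real k \<le> (\<Sum>i\<in>I. indicator (B i) \<omega>)"
      using card_rank_less_ge[OF I k, of "\<lambda>i. S (L \<omega>) (Z i \<omega>)"] by simp
  qed (use B in \<open>auto intro!: Bochner_Integration.integrable_sum simp: emeasure_eq_measure\<close>)
  also have "\<dots> = (\<Sum>i\<in>I. prob (B i))"
    using B by (subst Bochner_Integration.integral_sum)
      (auto simp: emeasure_eq_measure Int_absorb2 sets.sets_into_space intro!: sum.cong)
  also have "\<dots> = real (card I) * prob (B j)"
    using eq by simp
  finally show "real k \<le> real (card I) *
      prob {\<omega>\<in>space M. card {i\<in>I. S (L \<omega>) (Z i \<omega>) < S (L \<omega>) (Z j \<omega>)} < k}"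
    by (simp add: B_def)
qed

lemma pmf_replicate_pmf:
  "pmf (replicate_pmf m p) xs = (if length xs = m then \<Prod>x\<leftarrow>xs. pmf p x else 0)"
proof (induction m arbitrary: xs)
  case 0
  then show ?case by (auto simp: indicator_def)
next
  case (Suc m)
  show ?case
  proof (cases xs)
    case Nil
    then have "xs \<notin> set_pmf (replicate_pmf (Suc m) p)"
      unfolding set_replicate_pmf by simp
    then show ?thesis using Nil by (simp add: set_pmf_iff del: replicate_pmf.simps)
  next
    case (Cons a as)
    have "replicate_pmf (Suc m) p = map_pmf (\<lambda>(x, xs). x # xs) (pair_pmf p (replicate_pmf m p))"
      by (simp add: pair_pmf_def map_bind_pmf)
    moreover have "pmf (map_pmf (\<lambda>(x, xs). x # xs) (pair_pmf p (replicate_pmf m p)))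
        ((\<lambda>(x, xs). x # xs) (a, as)) = pmf (pair_pmf p (replicate_pmf m p)) (a, as)"
      by (rule pmf_map_inj') (auto simp: inj_def)
    ultimately show ?thesis
      using Cons Suc.IH[of as] by (simp add: pmf_pair)
  qed
qed

lemma borel_measurable_pmf_replicate_pmf:
  fixes llm :: "'x \<Rightarrow> 'r::countable pmf"
  assumes "(\<lambda>x. measure_pmf (llm x)) \<in> MX \<rightarrow>\<^sub>M subprob_algebra (count_space UNIV)"
  shows "(\<lambda>x. pmf (replicate_pmf m (llm x)) rs) \<in> borel_measurable MX"
proof -
  have [measurable]: "(\<lambda>x. pmf (llm x) y) \<in> borel_measurable MX" for y
    unfolding pmf.rep_eq
    using measurable_compose[OF assms measurable_measure_subprob_algebra[of "{y}"]] by simp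
  have "(\<lambda>x. \<Prod>y\<leftarrow>rs. pmf (llm x) y) \<in> borel_measurable MX"
    by (induction rs) simp_all
  then show ?thesis
    unfolding pmf_replicate_pmf by simp
qed

lemma borel_measurable_lofree_score:
  "(\<lambda>lam. lofree_score emb top_resp lam rs y) \<in> borel_measurable borel"
proof -
  have fst_snd: "(fst :: real \<times> real \<Rightarrow> real) \<in> borel_measurable borel"
      "(snd :: real \<times> real \<Rightarrow> real) \<in> borel_measurable borel"
    by (auto intro!: borel_measurable_continuous_onI continuous_intros)
  have "(\<lambda>lam. pool_score emb top_resp lam rs y) \<in> borel_measurable borel"
    unfolding pool_score_def using fst_snd
    by (cases "y = top_resp rs") (auto intro!: borel_measurable_diff borel_measurable_add borel_measurable_times)
  then show ?thesis
    unfolding lofree_score_def by (cases "y \<in> set rs") simp_all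
qed

lemma (in prob_space) prob_sampled_from_llm:
  fixes Y :: "nat \<Rightarrow> 'a \<Rightarrow> 'r::countable"
  assumes I: "finite I" "I \<noteq> {}"
    and indep: "indep_vars (\<lambda>_. MX \<Otimes>\<^sub>M count_space UNIV) (\<lambda>i \<omega>. (X i \<omega>, Y i \<omega>)) I"
    and ident: "\<And>i. i \<in> I \<Longrightarrow>
      distr M (MX \<Otimes>\<^sub>M count_space UNIV) (\<lambda>\<omega>. (X i \<omega>, Y i \<omega>)) = D"
    and llm: "(\<lambda>x. measure_pmf (llm x)) \<in> MX \<rightarrow>\<^sub>M subprob_algebra (count_space UNIV)"
    and sampled: "sampled_from_llm M MX llm m I X Y R"
  shows "prob {\<omega>\<in>space M. \<forall>i\<in>I. Y i \<omega> = y i \<and> R i \<omega> = rs i} =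
    (\<Prod>i\<in>I. \<integral>(x, y'). indicator {y i} y' * pmf (replicate_pmf m (llm x)) (rs i) \<partial>D)"
proof -
  define P where "P = MX \<Otimes>\<^sub>M count_space (UNIV :: 'r set)"
  define \<xi> where "\<xi> i \<omega> = (X i \<omega>, Y i \<omega>)" for i \<omega>
  define T where "T \<omega> = (\<lambda>i\<in>I. \<xi> i \<omega>)" for \<omega>
  define F where "F = vimage_algebra (space M) T (\<Pi>\<^sub>M i\<in>I. P)"
  define A where "A = {\<omega>\<in>space M. \<forall>i\<in>I. Y i \<omega> = y i}"
  define E where "E = {\<omega>\<in>space M. \<forall>i\<in>I. R i \<omega> = rs i}"
  define g where "g i = (\<lambda>(x, y'). indicator {y i} y' * pmf (replicate_pmf m (llm x)) (rs i))" for i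
  have \<xi>[measurable]: "\<xi> i \<in> M \<rightarrow>\<^sub>M P" if "i \<in> I" for i
    using indep that unfolding indep_vars_def P_def \<xi>_def by auto
  have R[measurable]: "R i \<in> M \<rightarrow>\<^sub>M count_space UNIV" if "i \<in> I" for i
    using sampled that by (auto simp: sampled_from_llm_def)
  have T: "T \<in> M \<rightarrow>\<^sub>M (\<Pi>\<^sub>M i\<in>I. P)"
    unfolding T_def by (rule measurable_restrict) (rule \<xi>)
  have g[measurable]: "g i \<in> borel_measurable P" for i
  proof -
    note borel_measurable_pmf_replicate_pmf[OF llm, measurable]
    show ?thesis unfolding g_def P_def by measurable
  qed
  have "subalgebra M F"
    unfolding subalgebra_def F_def using T
    by (auto simp: sets_vimage_algebra2 measurable_space intro: measurable_sets)
  then interpret finite_measure_subalgebra M F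
    by unfold_locales
  have "A \<in> sets F"
  proof -
    have "{z\<in>space (\<Pi>\<^sub>M i\<in>I. P). \<forall>i\<in>I. snd (z i) = y i} \<in> sets (\<Pi>\<^sub>M i\<in>I. P)"
      unfolding P_def using I by measurable
    then have "T -` {z\<in>space (\<Pi>\<^sub>M i\<in>I. P). \<forall>i\<in>I. snd (z i) = y i} \<inter> space M \<in> sets F"
      unfolding F_def by (rule in_vimage_algebra)
    also have "T -` {z\<in>space (\<Pi>\<^sub>M i\<in>I. P). \<forall>i\<in>I. snd (z i) = y i} \<inter> space M = A"
      using measurable_space[OF T] by (auto simp: A_def T_def \<xi>_def)
    finally show ?thesis .
  qed
  then have A: "A \<in> events"
    using \<open>subalgebra M F\<close> by (auto simp: subalgebra_def)
  have E[measurable]: "E \<in> events"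
    unfolding E_def using I by measurable
  have "{\<omega>\<in>space M. \<forall>i\<in>I. Y i \<omega> = y i \<and> R i \<omega> = rs i} = A \<inter> E"
    by (auto simp: A_def E_def)
  then have "prob {\<omega>\<in>space M. \<forall>i\<in>I. Y i \<omega> = y i \<and> R i \<omega> = rs i} =
      (\<integral>\<omega>\<in>A. indicator E \<omega> \<partial>M)"
    using A E unfolding set_lebesgue_integral_def
    by (simp add: indicator_inter_arith[symmetric] Int_absorb2 sets.sets_into_space sets.Int)
  also have "\<dots> = (\<integral>\<omega>\<in>A. real_cond_exp M F (indicator E) \<omega> \<partial>M)"
    using \<open>A \<in> sets F\<close> by (intro real_cond_exp_intA) (auto simp: emeasure_eq_measure)
  also have "\<dots> = (\<integral>\<omega>. (\<Prod>i\<in>I. g i (\<xi> i \<omega>)) \<partial>M)"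
    unfolding set_lebesgue_integral_def
  proof (rule integral_cong_AE)
    have "AE \<omega> in M. real_cond_exp M F (indicator E) \<omega> =
        (\<Prod>i\<in>I. pmf (replicate_pmf m (llm (X i \<omega>))) (rs i))"
      using sampled unfolding sampled_from_llm_def F_def T_def[abs_def] \<xi>_def P_def E_def by blast
    then show "AE \<omega> in M. indicator A \<omega> *\<^sub>R real_cond_exp M F (indicator E) \<omega> =
        (\<Prod>i\<in>I. g i (\<xi> i \<omega>))"
    proof (rule AE_mp, intro AE_I2 impI)
      fix \<omega> assume \<omega>: "\<omega> \<in> space M"
        and ce: "real_cond_exp M F (indicator E) \<omega> =
          (\<Prod>i\<in>I. pmf (replicate_pmf m (llm (X i \<omega>))) (rs i))"
      have "(indicator A \<omega> :: real) = (\<Prod>i\<in>I. indicator {y i} (Y i \<omega>))"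
        using I \<omega> by (auto simp: A_def indicator_def)
      then show "indicator A \<omega> *\<^sub>R real_cond_exp M F (indicator E) \<omega> = (\<Prod>i\<in>I. g i (\<xi> i \<omega>))"
        by (simp add: ce g_def \<xi>_def prod.distrib)
    qed
  qed (use A in measurable)
  also have "\<dots> = (\<Prod>i\<in>I. \<integral>\<omega>. g i (\<xi> i \<omega>) \<partial>M)"
  proof (rule indep_vars_lebesgue_integral[OF I(1)])
    show "indep_vars (\<lambda>_. borel) (\<lambda>i \<omega>. g i (\<xi> i \<omega>)) I"
      using indep unfolding \<xi>_def P_def[symmetric] by (rule indep_vars_compose2) (rule g)
    show "integrable M (\<lambda>\<omega>. g i (\<xi> i \<omega>))" if "i \<in> I" for i
    proof (rule integrable_const_bound[where B = 1])
      show "AE \<omega> in M. norm (g i (\<xi> i \<omega>)) \<le> 1"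
        by (auto simp: g_def indicator_def pmf_le_1 split: prod.split)
      show "(\<lambda>\<omega>. g i (\<xi> i \<omega>)) \<in> borel_measurable M"
        using that by measurable
    qed
  qed
  also have "\<dots> = (\<Prod>i\<in>I. \<integral>z. g i z \<partial>D)"
  proof (rule prod.cong)
    fix i assume i: "i \<in> I"
    then have "D = distr M P (\<xi> i)"
      using ident by (simp add: P_def \<xi>_def[abs_def])
    then show "(\<integral>\<omega>. g i (\<xi> i \<omega>) \<partial>M) = (\<integral>z. g i z \<partial>D)"
      using i by (simp add: integral_distr)
  qed simp
  finally show ?thesis
    by (simp add: g_def)
qed

theorem proposition3p2:
  fixes M :: "'w measure"
    and MX :: "'x measure"
    and X :: "nat \<Rightarrow> 'w \<Rightarrow> 'x"
    and Y :: "nat \<Rightarrow> 'w \<Rightarrow> 'r::countable"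
    and R :: "nat \<Rightarrow> 'w \<Rightarrow> 'r list"
    and Lam :: "'w \<Rightarrow> real \<times> real"
    and llm :: "'x \<Rightarrow> 'r pmf"
    and emb :: "'r \<Rightarrow> 'v::real_inner"
    and top_resp :: "'r list \<Rightarrow> 'r"
    and qhat :: "'w \<Rightarrow> ereal"
    and n m :: nat
    and \<alpha> :: real
  assumes "prob_space M"
    and "0 < n" and "0 < m" and "0 < \<alpha>" and "\<alpha> < 1"
    and "prob_space.indep_vars M (\<lambda>_. MX \<Otimes>\<^sub>M count_space UNIV)
           (\<lambda>i \<omega>. (X i \<omega>, Y i \<omega>)) {1..n+1}"
    and "\<forall>i\<in>{1..n+1}. distr M (MX \<Otimes>\<^sub>M count_space UNIV) (\<lambda>\<omega>. (X i \<omega>, Y i \<omega>)) =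
           distr M (MX \<Otimes>\<^sub>M count_space UNIV) (\<lambda>\<omega>. (X (n+1) \<omega>, Y (n+1) \<omega>))"
    and "(\<lambda>x. measure_pmf (llm x)) \<in> MX \<rightarrow>\<^sub>M subprob_algebra (count_space UNIV)"
    and "sampled_from_llm M MX llm m {1..n+1} X Y R"
    and "highest_freq_rule top_resp"
    and "indep_rvs M
           borel Lam
           (\<Pi>\<^sub>M i\<in>{1..n+1}. MX \<Otimes>\<^sub>M count_space UNIV \<Otimes>\<^sub>M count_space UNIV)
           (\<lambda>\<omega>. \<lambda>i\<in>{1..n+1}. (X i \<omega>, Y i \<omega>, R i \<omega>))"
    and "\<forall>\<omega>. qhat \<omega> = conformal_quantile \<alpha> n
           (\<lambda>i. lofree_score emb top_resp (Lam \<omega>) (R i \<omega>) (Y i \<omega>))"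
  shows "((AE \<omega> in M. qhat \<omega> = \<infinity> \<longrightarrow> Y (n+1) \<omega> \<in> set (R (n+1) \<omega>)) \<longrightarrow>
           measure M {\<omega>\<in>space M. Y (n+1) \<omega> \<in>
             lofree_set emb top_resp (Lam \<omega>) (R (n+1) \<omega>) (qhat \<omega>)} \<ge> 1 - \<alpha>) \<and>
         measure M {\<omega>\<in>space M. Y (n+1) \<omega> \<in>
           lofree_set_ext emb top_resp (Lam \<omega>) (R (n+1) \<omega>) (qhat \<omega>)} \<ge> 1 - \<alpha>"
proof -
  interpret prob_space M by fact
  define I where "I = {1..n+1}"
  define Z where "Z i \<omega> = (Y i \<omega>, R i \<omega>)" for i \<omega>
  define S where "S lam = (\<lambda>(y, rs). lofree_score emb top_resp lam rs y)" for lam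
  define k where "k = nat \<lceil>(real n + 1) * (1 - \<alpha>)\<rceil>"
  define B where "B = {\<omega>\<in>space M.
    card {i\<in>I. S (Lam \<omega>) (Z i \<omega>) < S (Lam \<omega>) (Z (n + 1) \<omega>)} < k}"
  have I: "finite I" "n + 1 \<in> I" "I \<noteq> {}" "card I = n + 1"
    by (auto simp: I_def)
  have Y: "Y i \<in> M \<rightarrow>\<^sub>M count_space UNIV" if "i \<in> I" for i
  proof -
    have "(\<lambda>\<omega>. (X i \<omega>, Y i \<omega>)) \<in> M \<rightarrow>\<^sub>M MX \<Otimes>\<^sub>M count_space UNIV"
      using assms(6) that by (auto simp: indep_vars_def I_def)
    from measurable_compose[OF this measurable_snd] show ?thesis by simp
  qed
  have R: "R i \<in> M \<rightarrow>\<^sub>M count_space UNIV" if "i \<in> I" for i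
    using assms(9) that by (auto simp: sampled_from_llm_def I_def)
  note [measurable] = Y R
  have Z: "Z i \<in> M \<rightarrow>\<^sub>M count_space UNIV" if "i \<in> I" for i
  proof -
    have "(\<lambda>\<omega>. (Y i \<omega>, R i \<omega>)) \<in> M \<rightarrow>\<^sub>M count_space UNIV \<Otimes>\<^sub>M count_space UNIV"
      using Y[OF that] R[OF that] by (rule measurable_Pair)
    then show ?thesis
      by (simp add: Z_def[abs_def] pair_measure_countable)
  qed
  have Lam: "Lam \<in> M \<rightarrow>\<^sub>M borel"
    using assms(11) by (simp add: indep_rvs_def)
  have S: "(\<lambda>lam. S lam c) \<in> borel_measurable borel" for c
    by (cases c) (simp add: S_def borel_measurable_lofree_score)
  have exch: "prob {\<omega>\<in>space M. \<forall>i\<in>I. Z i \<omega> = z (\<sigma> i)} = prob {\<omega>\<in>space M. \<forall>i\<in>I. Z i \<omega> = z i}"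
    if \<sigma>: "\<sigma> permutes I" for \<sigma> z
  proof -
    define \<phi> where "\<phi> c = (\<integral>(x, y'). indicator {fst c} y' * pmf (replicate_pmf m (llm x)) (snd c)
      \<partial>distr M (MX \<Otimes>\<^sub>M count_space UNIV) (\<lambda>\<omega>. (X (n + 1) \<omega>, Y (n + 1) \<omega>)))" for c
    have law: "prob {\<omega>\<in>space M. \<forall>i\<in>I. Z i \<omega> = z i} = (\<Prod>i\<in>I. \<phi> (z i))" for z
    proof -
      have "{\<omega>\<in>space M. \<forall>i\<in>I. Z i \<omega> = z i} =
          {\<omega>\<in>space M. \<forall>i\<in>I. Y i \<omega> = fst (z i) \<and> R i \<omega> = snd (z i)}"
        by (simp add: Z_def prod_eq_iff)
      then show ?thesis
        unfolding \<phi>_def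
        using prob_sampled_from_llm[OF I(1,3) assms(6)[folded I_def] bspec[OF assms(7)[folded I_def]]
            assms(8) assms(9)[folded I_def], of "\<lambda>i. fst (z i)" "\<lambda>i. snd (z i)"]
        by (simp only:)
    qed
    show ?thesis
      unfolding law using prod.permute[OF \<sigma>, of "\<lambda>i. \<phi> (z i)"] by (simp add: comp_def)
  qed
  have indep: "prob {\<omega>\<in>space M. Lam \<omega> \<in> A \<and> (\<forall>i\<in>I. Z i \<omega> = z i)} =
      prob {\<omega>\<in>space M. Lam \<omega> \<in> A} * prob {\<omega>\<in>space M. \<forall>i\<in>I. Z i \<omega> = z i}"
    if A: "A \<in> sets borel" for A z
  proof -
    define V where "V \<omega> = (\<lambda>i\<in>I. (X i \<omega>, Y i \<omega>, R i \<omega>))" for \<omega>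
    define P where "P = (\<Pi>\<^sub>M i\<in>I. MX \<Otimes>\<^sub>M count_space (UNIV :: 'r set) \<Otimes>\<^sub>M count_space (UNIV :: 'r list set))"
    define C where "C = {v\<in>space P. \<forall>i\<in>I. fst (snd (v i)) = fst (z i) \<and> snd (snd (v i)) = snd (z i)}"
    have V: "V \<in> M \<rightarrow>\<^sub>M P"
      and ind: "indep_set (sets (vimage_algebra (space M) Lam borel)) (sets (vimage_algebra (space M) V P))"
      using assms(11) by (auto simp: indep_rvs_def V_def[abs_def] P_def I_def)
    have "C \<in> sets P"
      unfolding C_def P_def using I by measurable
    then have "prob ((Lam -` A \<inter> space M) \<inter> (V -` C \<inter> space M)) =
        prob (Lam -` A \<inter> space M) * prob (V -` C \<inter> space M)"
      using A by (intro indep_setD[OF ind] in_vimage_algebra)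
    moreover have "V -` C \<inter> space M = {\<omega>\<in>space M. \<forall>i\<in>I. Z i \<omega> = z i}"
      using measurable_space[OF V] by (auto simp: C_def V_def Z_def prod_eq_iff)
    moreover have "Lam -` A \<inter> space M = {\<omega>\<in>space M. Lam \<omega> \<in> A}" by auto
    moreover have "{\<omega>\<in>space M. Lam \<omega> \<in> A} \<inter> {\<omega>\<in>space M. \<forall>i\<in>I. Z i \<omega> = z i} =
        {\<omega>\<in>space M. Lam \<omega> \<in> A \<and> (\<forall>i\<in>I. Z i \<omega> = z i)}" by auto
    ultimately show ?thesis by simp
  qed
  have k: "k \<le> card I"
  proof -
    have "(real n + 1) * (1 - \<alpha>) \<le> real n + 1"
      using assms(4) by (intro mult_left_le) auto
    then show ?thesis
      unfolding k_def I(4) by (simp add: nat_le_iff ceiling_le_iff add.commute)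
  qed
  have B: "B \<in> events" and rank: "real k \<le> real (card I) * prob B"
    unfolding B_def
    by (rule prob_rank_less_ge[where S = S, OF I(1) Lam Z indep exch S I(2) k]; assumption)+
  have "(real n + 1) * (1 - \<alpha>) \<le> real k"
    unfolding k_def by linarith
  also have "real k \<le> (real n + 1) * prob B"
    using rank by (simp add: I(4) add.commute)
  finally have "(real n + 1) * (1 - \<alpha>) \<le> (real n + 1) * prob B" .
  then have prob_B: "1 - \<alpha> \<le> prob B"
    by (simp add: mult_le_cancel_left)
  have B_iff: "\<omega> \<in> B \<longleftrightarrow> \<omega> \<in> space M \<and> lofree_score emb top_resp (Lam \<omega>) (R (n+1) \<omega>) (Y (n+1) \<omega>) \<le> qhat \<omega>" for \<omega>
    using le_conformal_quantile_iff[OF assms(2,5),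
        of "\<lambda>i. lofree_score emb top_resp (Lam \<omega>) (R i \<omega>) (Y i \<omega>)"] assms(12)
    by (simp add: B_def S_def Z_def I_def k_def)
  then have ext: "{\<omega>\<in>space M. Y (n+1) \<omega> \<in>
      lofree_set_ext emb top_resp (Lam \<omega>) (R (n+1) \<omega>) (qhat \<omega>)} = B"
    by (auto simp: lofree_set_ext_def)
  have "1 - \<alpha> \<le> prob {\<omega>\<in>space M. Y (n+1) \<omega> \<in> lofree_set emb top_resp (Lam \<omega>) (R (n+1) \<omega>) (qhat \<omega>)}"
    if ae: "AE \<omega> in M. qhat \<omega> = \<infinity> \<longrightarrow> Y (n+1) \<omega> \<in> set (R (n+1) \<omega>)"
  proof -
    have pool: "{\<omega>\<in>space M. Y (n+1) \<omega> \<in> lofree_set emb top_resp (Lam \<omega>) (R (n+1) \<omega>) (qhat \<omega>)} =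
        B \<inter> {\<omega>\<in>space M. Y (n+1) \<omega> \<in> set (R (n+1) \<omega>)}"
      by (auto simp: B_iff lofree_set_def lofree_score_def)
    have "Z (n+1) -` {(y, rs). y \<in> set rs} \<inter> space M \<in> events"
      using Z[OF I(2)] by (rule measurable_sets) simp
    also have "Z (n+1) -` {(y, rs). y \<in> set rs} \<inter> space M =
        {\<omega>\<in>space M. Y (n+1) \<omega> \<in> set (R (n+1) \<omega>)}"
      by (auto simp: Z_def)
    finally have "B \<inter> {\<omega>\<in>space M. Y (n+1) \<omega> \<in> set (R (n+1) \<omega>)} \<in> events"
      using B by blast
    moreover have "AE \<omega> in M. \<omega> \<in> B \<longrightarrow> \<omega> \<in> B \<inter> {\<omega>\<in>space M. Y (n+1) \<omega> \<in> set (R (n+1) \<omega>)}"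
      using ae by (rule AE_mp) (auto intro!: AE_I2 simp: B_iff lofree_score_def split: if_splits)
    ultimately have "prob B \<le> prob (B \<inter> {\<omega>\<in>space M. Y (n+1) \<omega> \<in> set (R (n+1) \<omega>)})"
      by (intro finite_measure_mono_AE)
    with prob_B show ?thesis unfolding pool by linarith
  qed
  then show ?thesis
    using prob_B unfolding ext by blast
qed

end
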